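(* Let $\lambda_1$ be the first (smallest) eigenvalue of the discrete fractional Sturm--Liouville problem $${_{k}}\Delta^{\alpha}_{N}\left(p(x_k)\,{_{0}}\Delta^{\alpha}_{k}y(x_k)\right)+q(x_k)y(x_k)=\lambda r(x_k)y(x_k), \quad k=1,\ldots,N-1,\qquad y(x_0)=y(x_N)=0,$$ and let $y^1$ denote the first eigenfunction, i.e. an eigenfunction associated to $\lambda_1$, normalized to satisfy the isoperimetric constraint $$I[y]=\sum_{k=1}^{N}r(x_{k})(y(x_{k}))^2=1.$$ Then $y^1$ is a minimizer of the functional $$J[y]=\sum_{k=1}^{N}\left[p(x_k)\left({_{0}}\Delta^{\alpha}_{k}y(x_k)\right)^2+q(x_k)(y(x_k))^2\right]$$ over functions $y:D\to\mathbb{R}$ subject to the boundary conditions $y(x_0)=0$, $y(x_N)=0$ and the isoperimetric constraint $I[y]=1$. Moreover, $J[y^1]=\lambda_1$.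
   Context: Let $a\in\mathbb{R}$, $h>0$, let $N\ge 2$ be an integer, and let $0<\alpha\le 1$. Put $x_j=a+jh$ for $j=0,1,\ldots,N$ and $D=\{x_0,\ldots,x_N\}$. Define $$a_0^{(\alpha)}:=1,\qquad a_i^{(\alpha)}:=(-1)^i\frac{\alpha(\alpha-1)\cdots(\alpha-i+1)}{i!}\quad (i=1,2,\ldots).$$ For $f:D\to\mathbb{R}$ and $k=0,\ldots,N$, the backward and forward (Grünwald--Letnikov) fractional differences of order $\alpha$ are $${_{0}}\Delta^{\alpha}_{k}f(x_k):=\frac{1}{h^{\alpha}}\sum_{i=0}^{k}a_i^{(\alpha)}f(x_{k-i}),\qquad {_{k}}\Delta^{\alpha}_{N}f(x_k):=\frac{1}{h^{\alpha}}\sum_{i=0}^{N-k}a_i^{(\alpha)}f(x_{k+i}).$$ In ${_{k}}\Delta^{\alpha}_{N}\left(p(x_k)\,{_{0}}\Delta^{\alpha}_{k}y(x_k)\right)$ the forward difference is applied to the function $x_j\mapsto p(x_j)\,{_{0}}\Delta^{\alpha}_{j}y(x_j)$ on $D$, evaluated at $x_k$. The functions $p,q,r:D\to\mathbb{R}$ satisfy $p(x_i)>0$ and $r(x_i)>0$ for all $i=0,\ldots,N$ ($q$ is an arbitrary real-valued function). The number $\lambda$ is a parameter. An eigenfunction is a nontrivial solution $y:D\to\mathbb{R}$ of the boundary value problem, and the corresponding value of $\lambda$ is an eigenvalue. The problem has $N-1$ real eigenvalues counted with multiplicity, ordered as $\lambda_1\le\lambda_2\le\cdots\le\lambda_{N-1}$.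 *)

theory Defs
  imports Complex_Main
begin

definition grid :: "real \<Rightarrow> real \<Rightarrow> nat \<Rightarrow> real" where
  "grid a h j = a + real j * h"

text \<open>Since \<open>\<alpha> gchoose i\<close> is \<open>\<alpha> (\<alpha> - 1) \<dots> (\<alpha> - i + 1) / i!\<close>, these are the
  coefficients of the binomial series of \<open>(1 - z)\<close> to the power \<open>\<alpha>\<close>.\<close>

definition gl_coeff :: "real \<Rightarrow> nat \<Rightarrow> real" where
  "gl_coeff \<alpha> i = (-1) ^ i * (\<alpha> gchoose i)"

text \<open>The difference operators act on a function \<open>f\<close> on the grid points through its sequence of
  values \<open>j \<mapsto> f (x\<^sub>j)\<close>, so that they can be composed. Everywhere else a function on
  \<open>D = {x\<^sub>0, \<dots>, x\<^sub>N}\<close> is a function on \<open>\<real>\<close> of which only the values on \<open>D\<close> are ever used.\<close>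

definition backward_diff :: "real \<Rightarrow> real \<Rightarrow> (nat \<Rightarrow> real) \<Rightarrow> nat \<Rightarrow> real" where
  "backward_diff h \<alpha> f k = 1 / h powr \<alpha> * (\<Sum>i=0..k. gl_coeff \<alpha> i * f (k - i))"

definition forward_diff :: "real \<Rightarrow> real \<Rightarrow> nat \<Rightarrow> (nat \<Rightarrow> real) \<Rightarrow> nat \<Rightarrow> real" where
  "forward_diff h \<alpha> N f k = 1 / h powr \<alpha> * (\<Sum>i=0..N-k. gl_coeff \<alpha> i * f (k + i))"

definition sl_solution ::
  "real \<Rightarrow> real \<Rightarrow> nat \<Rightarrow> real \<Rightarrow> (real \<Rightarrow> real) \<Rightarrow> (real \<Rightarrow> real) \<Rightarrow> (real \<Rightarrow> real)
    \<Rightarrow> real \<Rightarrow> (real \<Rightarrow> real) \<Rightarrow> bool" where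
  "sl_solution a h N \<alpha> p q r lam y \<longleftrightarrow>
     (\<forall>k\<in>{1..N-1}.
        forward_diff h \<alpha> N
          (\<lambda>j. p (grid a h j) * backward_diff h \<alpha> (\<lambda>i. y (grid a h i)) j) k
        + q (grid a h k) * y (grid a h k)
        = lam * r (grid a h k) * y (grid a h k))
     \<and> y (grid a h 0) = 0 \<and> y (grid a h N) = 0"

definition sl_eigenfunction ::
  "real \<Rightarrow> real \<Rightarrow> nat \<Rightarrow> real \<Rightarrow> (real \<Rightarrow> real) \<Rightarrow> (real \<Rightarrow> real) \<Rightarrow> (real \<Rightarrow> real)
    \<Rightarrow> real \<Rightarrow> (real \<Rightarrow> real) \<Rightarrow> bool" where
  "sl_eigenfunction a h N \<alpha> p q r lam y \<longleftrightarrow>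
     sl_solution a h N \<alpha> p q r lam y \<and> (\<exists>k\<in>{0..N}. y (grid a h k) \<noteq> 0)"

definition sl_eigenvalue ::
  "real \<Rightarrow> real \<Rightarrow> nat \<Rightarrow> real \<Rightarrow> (real \<Rightarrow> real) \<Rightarrow> (real \<Rightarrow> real) \<Rightarrow> (real \<Rightarrow> real)
    \<Rightarrow> real \<Rightarrow> bool" where
  "sl_eigenvalue a h N \<alpha> p q r lam \<longleftrightarrow> (\<exists>y. sl_eigenfunction a h N \<alpha> p q r lam y)"

definition first_sl_eigenvalue ::
  "real \<Rightarrow> real \<Rightarrow> nat \<Rightarrow> real \<Rightarrow> (real \<Rightarrow> real) \<Rightarrow> (real \<Rightarrow> real) \<Rightarrow> (real \<Rightarrow> real)
    \<Rightarrow> real \<Rightarrow> bool" where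
  "first_sl_eigenvalue a h N \<alpha> p q r lam \<longleftrightarrow>
     sl_eigenvalue a h N \<alpha> p q r lam \<and> (\<forall>\<mu>. sl_eigenvalue a h N \<alpha> p q r \<mu> \<longrightarrow> lam \<le> \<mu>)"

definition functional_I ::
  "real \<Rightarrow> real \<Rightarrow> nat \<Rightarrow> (real \<Rightarrow> real) \<Rightarrow> (real \<Rightarrow> real) \<Rightarrow> real" where
  "functional_I a h N r y = (\<Sum>k=1..N. r (grid a h k) * (y (grid a h k))\<^sup>2)"

definition functional_J ::
  "real \<Rightarrow> real \<Rightarrow> nat \<Rightarrow> real \<Rightarrow> (real \<Rightarrow> real) \<Rightarrow> (real \<Rightarrow> real) \<Rightarrow> (real \<Rightarrow> real) \<Rightarrow> real" where
  "functional_J a h N \<alpha> p q y =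
     (\<Sum>k=1..N. p (grid a h k) * (backward_diff h \<alpha> (\<lambda>i. y (grid a h i)) k)\<^sup>2
               + q (grid a h k) * (y (grid a h k))\<^sup>2)"

end

theory Submission
  imports Defs "HOL-Analysis.Function_Topology"
begin

text \<open>The two difference operators are adjoint to each other (\<open>fractional_summation_by_parts\<close>),
  so the Sturm--Liouville operator is the operator of the symmetric bilinear form \<open>energy\<close> whose
  quadratic form is \<open>J\<close>: a solution \<open>y\<close> with parameter \<open>\<lambda>\<close> satisfies
  \<open>energy y v = \<lambda> \<Sum> r y v\<close> for every \<open>v\<close> that vanishes at both ends, and conversely
  (\<open>energy_weak_form\<close>). Taking \<open>v = y\<close> gives \<open>J[y] = \<lambda> I[y]\<close>, hence \<open>J[y\<^sub>1] = \<lambda>\<^sub>1\<close>.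

  That no admissible function has smaller \<open>J\<close> is the Rayleigh principle. The admissible functions
  form an ellipsoid in a finite-dimensional space, so \<open>J\<close> has a minimizer \<open>m\<close> there. The first-order
  condition at \<open>m\<close> (\<open>rayleigh_minimizer\<close>) says that \<open>m\<close> is an eigenfunction with
  eigenvalue \<open>J[m]\<close>. As \<open>\<lambda>\<^sub>1\<close> is the smallest eigenvalue, \<open>\<lambda>\<^sub>1 \<le> J[m]\<close>, and therefore
  \<open>\<lambda>\<^sub>1\<close> is a lower bound of \<open>J\<close> on all admissible functions, attained at \<open>y\<^sub>1\<close>.\<close>

section \<open>The Rayleigh principle for a quadratic form in finitely many coordinates\<close>

text \<open>Vectors with coordinates in \<open>S\<close> are encoded as functions that vanish off \<open>S\<close>. In the product
  topology the ellipsoid is a closed subset of a product of compact intervals, which are degenerate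
  off \<open>S\<close>, so Tychonoff's theorem applies.\<close>

lemma compact_weighted_sphere:
  fixes w :: "'i \<Rightarrow> real"
  assumes "finite S" and w: "\<And>k. k \<in> S \<Longrightarrow> w k > 0"
  shows "compact {u :: 'i \<Rightarrow> real. (\<forall>k. k \<notin> S \<longrightarrow> u k = 0) \<and> (\<Sum>k\<in>S. w k * (u k)\<^sup>2) = 1}"
    (is "compact ?K")
proof -
  \<comment> \<open>A single term of the weighted sum is at most \<open>1\<close>, which bounds each coordinate.\<close>
  define R where "R k = (if k \<in> S then sqrt (1 / w k) else 0)" for k
  have "compactin (product_topology (\<lambda>_. euclidean) UNIV) (Pi\<^sub>E UNIV (\<lambda>k. {- R k..R k}))"
    by (subst compactin_PiE) (auto simp: compactin_euclidean_iff)
  then have box: "compact (Pi\<^sub>E UNIV (\<lambda>k. {- R k..R k}))"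
    by (simp add: euclidean_product_topology compactin_euclidean_iff)
  have coord: "continuous_on UNIV (\<lambda>u :: 'i \<Rightarrow> real. u k)" for k
    by (rule continuous_on_product_coordinates)
  have "closed {u :: 'i \<Rightarrow> real. (\<forall>k. k \<in> - S \<longrightarrow> u k = 0)}"
    unfolding Collect_all_eq imp_conv_disj Collect_disj_eq
    by (intro closed_INT ballI closed_Un closed_Collect_const closed_Collect_eq coord continuous_intros)
  then have "closed {u :: 'i \<Rightarrow> real. (\<forall>k. k \<notin> S \<longrightarrow> u k = 0)}"
    by simp
  moreover have "closed {u :: 'i \<Rightarrow> real. (\<Sum>k\<in>S. w k * (u k)\<^sup>2) = 1}"
    by (intro closed_Collect_eq continuous_intros coord)
  ultimately have "closed ?K"
    by (simp add: Collect_conj_eq closed_Int)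
  moreover have "?K \<subseteq> Pi\<^sub>E UNIV (\<lambda>k. {- R k..R k})"
  proof
    fix u assume u: "u \<in> ?K"
    have "\<bar>u k\<bar> \<le> R k" for k
    proof (cases "k \<in> S")
      case True
      have "w k * (u k)\<^sup>2 \<le> (\<Sum>k\<in>S. w k * (u k)\<^sup>2)"
        using \<open>finite S\<close> True less_imp_le[OF w] by (intro member_le_sum) simp_all
      then have "(u k)\<^sup>2 \<le> 1 / w k"
        using u w[OF True] by (simp add: field_simps)
      then show ?thesis
        using True by (auto simp: R_def intro: real_le_rsqrt)
    qed (use u in \<open>simp add: R_def\<close>)
    then show "u \<in> Pi\<^sub>E UNIV (\<lambda>k. {- R k..R k})"
      by (auto simp: PiE_iff abs_le_iff minus_le_iff)
  qed
  ultimately show ?thesis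
    using compact_Int_closed[OF box, of ?K] by (simp only: inf.absorb2)
qed

text \<open>A parabola through the origin that stays nonnegative has its vertex there; this is the
  first-order condition for a minimum of a quadratic functional along a line.\<close>

lemma nonneg_parabola_imp_linear_zero:
  fixes b c :: real
  assumes nonneg: "\<And>t. 0 \<le> 2 * t * b + t\<^sup>2 * c"
  shows "b = 0"
proof (rule ccontr)
  assume "b \<noteq> 0"
  \<comment> \<open>With \<open>t = - b / d\<close> the value is \<open>b\<^sup>2 / d * (c / d - 2)\<close>, negative because \<open>c < 2 * d\<close>.\<close>
  define d where "d = \<bar>c\<bar> + 1"
  have "d > 0" and "c < d" by (auto simp: d_def)
  have "2 * (- b / d) * b + (- b / d)\<^sup>2 * c = (b / d)\<^sup>2 * (c - 2 * d)"
    using \<open>d > 0\<close> by (simp add: field_simps power2_eq_square)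
  also have "\<dots> < 0"
    using \<open>b \<noteq> 0\<close> \<open>d > 0\<close> \<open>c < d\<close> by (intro mult_pos_neg) auto
  finally show False
    using nonneg[of "- b / d"] by simp
qed

text \<open>By homogeneity, minimality of \<open>m\<close> on the ellipsoid means that
  \<open>B v v - B m m * \<Sum> w v\<^sup>2\<close> is nonnegative on the whole space. It vanishes at \<open>m\<close>, so its
  linear part at \<open>m\<close> vanishes too, which is the eigenvalue equation in weak form.\<close>

lemma rayleigh_minimizer:
  fixes B :: "('i \<Rightarrow> real) \<Rightarrow> ('i \<Rightarrow> real) \<Rightarrow> real" and w :: "'i \<Rightarrow> real"
  assumes "finite S" and "S \<noteq> {}" and w: "\<And>k. k \<in> S \<Longrightarrow> w k > 0"
    and sym: "\<And>u v. B u v = B v u"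
    and lin: "\<And>u v z t. B (\<lambda>k. u k + t * v k) z = B u z + t * B v z"
    and cont: "continuous_on UNIV (\<lambda>u. B u u)"
  obtains m where "\<And>k. k \<notin> S \<Longrightarrow> m k = 0" and "(\<Sum>k\<in>S. w k * (m k)\<^sup>2) = 1"
    and "\<And>v. (\<And>k. k \<notin> S \<Longrightarrow> v k = 0) \<Longrightarrow> B m m * (\<Sum>k\<in>S. w k * (v k)\<^sup>2) \<le> B v v"
    and "\<And>v. (\<And>k. k \<notin> S \<Longrightarrow> v k = 0) \<Longrightarrow> B m v = B m m * (\<Sum>k\<in>S. w k * m k * v k)"
proof -
  define W where "W u v = (\<Sum>k\<in>S. w k * u k * v k)" for u v
  define K where "K = {u. (\<forall>k. k \<notin> S \<longrightarrow> u k = 0) \<and> (\<Sum>k\<in>S. w k * (u k)\<^sup>2) = 1}"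
  have W_diag: "W v v = (\<Sum>k\<in>S. w k * (v k)\<^sup>2)" for v
    by (simp add: W_def power2_eq_square mult.assoc)
  have W_expand: "W (\<lambda>k. u k + t * v k) (\<lambda>k. u k + t * v k) = W u u + 2 * t * W u v + t\<^sup>2 * W v v"
    for u v t
    by (simp add: W_def sum_distrib_left sum.distrib[symmetric] algebra_simps power2_eq_square)
  have B_expand: "B (\<lambda>k. u k + t * v k) (\<lambda>k. u k + t * v k) = B u u + 2 * t * B u v + t\<^sup>2 * B v v"
    for u v t
  proof -
    have right: "B z (\<lambda>k. u k + t * v k) = B z u + t * B z v" for z
      using lin[of u t v z] by (simp add: sym)
    show ?thesis
      by (simp add: lin right sym[of v u] algebra_simps power2_eq_square)
  qed
  have B_zero: "B (\<lambda>k. 0) z = 0" for z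
    using lin[of "\<lambda>k. 0" 1 "\<lambda>k. 0" z] by simp
  have B_scale: "B (\<lambda>k. t * v k) (\<lambda>k. t * v k) = t\<^sup>2 * B v v" for t v
    using B_expand[of "\<lambda>k. 0" t v] by (simp add: B_zero)

  from \<open>S \<noteq> {}\<close> obtain s where "s \<in> S" by blast
  have "(\<lambda>k. if k = s then 1 / sqrt (w s) else 0) \<in> K"
    using \<open>finite S\<close> \<open>s \<in> S\<close> w[OF \<open>s \<in> S\<close>]
    by (auto simp: K_def if_distrib[of "\<lambda>x. x\<^sup>2"] if_distrib[of "\<lambda>x. _ * x"] power_divide
        cong: if_cong)
  then have "K \<noteq> {}" by blast
  moreover have "compact K"
    unfolding K_def using \<open>finite S\<close> w by (rule compact_weighted_sphere)
  ultimately obtain m where "m \<in> K" and m_min: "\<And>u. u \<in> K \<Longrightarrow> B m m \<le> B u u"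
    using continuous_attains_inf[of K "\<lambda>u. B u u"] continuous_on_subset[OF cont] by auto
  have m_supp: "\<And>k. k \<notin> S \<Longrightarrow> m k = 0" and "W m m = 1"
    using \<open>m \<in> K\<close> by (auto simp: K_def W_diag)

  have lower: "B m m * W v v \<le> B v v" if v: "\<And>k. k \<notin> S \<Longrightarrow> v k = 0" for v
  proof (cases "W v v = 0")
    case True
    have "v k = 0" for k
    proof (cases "k \<in> S")
      assume "k \<in> S"
      have "w k * (v k)\<^sup>2 = 0"
        using True \<open>k \<in> S\<close> sum_nonneg_eq_0_iff[OF \<open>finite S\<close>, of "\<lambda>k. w k * (v k)\<^sup>2"] less_imp_le[OF w]
        unfolding W_diag by simp
      then show ?thesis
        using w[OF \<open>k \<in> S\<close>] by simp
    qed (rule v)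
    then have "v = (\<lambda>k. 0)" by auto
    then show ?thesis
      by (simp add: B_zero W_def)
  next
    case False
    have "W v v \<ge> 0"
      unfolding W_diag using w by (intro sum_nonneg mult_nonneg_nonneg) (auto intro: less_imp_le)
    with False have pos: "W v v > 0" by simp
    define t where "t = 1 / sqrt (W v v)"
    have t: "t\<^sup>2 = 1 / W v v"
      using pos by (simp add: t_def power_divide)
    have "(\<Sum>k\<in>S. w k * (t * v k)\<^sup>2) = t\<^sup>2 * W v v"
      by (simp add: W_diag sum_distrib_left power_mult_distrib mult_ac)
    then have "(\<lambda>k. t * v k) \<in> K"
      using v pos t by (simp add: K_def)
    then have "B m m \<le> t\<^sup>2 * B v v"
      using m_min[of "\<lambda>k. t * v k"] by (simp add: B_scale)
    then show ?thesis
      using pos by (simp add: t field_simps)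
  qed

  have stationary: "B m v = B m m * W m v" if v: "\<And>k. k \<notin> S \<Longrightarrow> v k = 0" for v
  proof -
    have "0 \<le> 2 * t * (B m v - B m m * W m v) + t\<^sup>2 * (B v v - B m m * W v v)" for t
      using lower[of "\<lambda>k. m k + t * v k"] m_supp v \<open>W m m = 1\<close>
      by (simp add: B_expand W_expand algebra_simps)
    then have "B m v - B m m * W m v = 0"
      by (rule nonneg_parabola_imp_linear_zero)
    then show ?thesis by simp
  qed

  show thesis
    by (rule that[OF m_supp \<open>W m m = 1\<close>[unfolded W_diag] lower[unfolded W_diag]
          stationary[unfolded W_def]])
qed

section \<open>The energy form of the fractional Sturm--Liouville operator\<close>

text \<open>Both sides are the sum of \<open>gl_coeff \<alpha> i * f j * g (j + i)\<close> over all \<open>j + i \<le> N\<close>.\<close>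

lemma fractional_summation_by_parts:
  "(\<Sum>k=0..N. g k * backward_diff h \<alpha> f k) = (\<Sum>k=0..N. f k * forward_diff h \<alpha> N g k)"
proof -
  have "(\<Sum>k=0..N. \<Sum>i=0..k. g k * (gl_coeff \<alpha> i * f (k - i)))
      = (\<Sum>k=0..N. \<Sum>i=0..N-k. f k * (gl_coeff \<alpha> i * g (k + i)))"
    unfolding sum.Sigma[OF finite_atLeastAtMost ballI[OF finite_atLeastAtMost]]
    by (rule sum.reindex_bij_witness
        [where i = "\<lambda>(k, i). (k + i, i)" and j = "\<lambda>(k, i). (k - i, i)"]) auto
  then show ?thesis
    by (simp add: backward_diff_def forward_diff_def sum_distrib_left sum_divide_distrib[symmetric])
qed

definition energy ::
  "real \<Rightarrow> real \<Rightarrow> nat \<Rightarrow> (nat \<Rightarrow> real) \<Rightarrow> (nat \<Rightarrow> real) \<Rightarrow> (nat \<Rightarrow> real) \<Rightarrow> (nat \<Rightarrow> real) \<Rightarrow> real" where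
  "energy h \<alpha> N P Q u v =
     (\<Sum>k=1..N. P k * backward_diff h \<alpha> u k * backward_diff h \<alpha> v k + Q k * u k * v k)"

lemma functional_J_eq_energy:
  "functional_J a h N \<alpha> p q y =
     energy h \<alpha> N (\<lambda>k. p (grid a h k)) (\<lambda>k. q (grid a h k))
       (\<lambda>k. y (grid a h k)) (\<lambda>k. y (grid a h k))"
  by (simp add: functional_J_def energy_def power2_eq_square mult.assoc)

lemma energy_commute: "energy h \<alpha> N P Q u v = energy h \<alpha> N P Q v u"
  by (simp add: energy_def mult_ac)

lemma backward_diff_add_scale:
  "backward_diff h \<alpha> (\<lambda>k. u k + t * v k) k = backward_diff h \<alpha> u k + t * backward_diff h \<alpha> v k"
  unfolding backward_diff_def
  by (simp add: sum_distrib_left sum.distrib algebra_simps add_divide_distrib)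

lemma energy_add_scale_left:
  "energy h \<alpha> N P Q (\<lambda>k. u k + t * v k) z = energy h \<alpha> N P Q u z + t * energy h \<alpha> N P Q v z"
  unfolding energy_def backward_diff_add_scale
  by (simp add: sum_distrib_left sum.distrib[symmetric] algebra_simps)

lemma continuous_on_energy: "continuous_on UNIV (\<lambda>u. energy h \<alpha> N P Q u u)"
  unfolding energy_def backward_diff_def
  by (intro continuous_intros continuous_on_product_coordinates)

lemma energy_cong_upto:
  assumes "\<And>k. k \<le> N \<Longrightarrow> u k = v k"
  shows "energy h \<alpha> N P Q u u = energy h \<alpha> N P Q v v"
proof -
  have "backward_diff h \<alpha> u k = backward_diff h \<alpha> v k" if "k \<le> N" for k
    using that assms by (simp add: backward_diff_def)
  then show ?thesis
    using assms by (simp add: energy_def)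
qed

text \<open>Summation by parts moves the difference from the test sequence \<open>v\<close> to the flux. It runs
  from \<open>0\<close>, while \<open>energy\<close> starts at \<open>1\<close>; the extra term vanishes as the backward difference
  of \<open>v\<close> at \<open>0\<close> is a multiple of \<open>v 0\<close>.\<close>

lemma energy_weak_form:
  assumes "v 0 = 0" and "v N = 0"
  shows "energy h \<alpha> N P Q u v =
    (\<Sum>k=1..N-1. (forward_diff h \<alpha> N (\<lambda>j. P j * backward_diff h \<alpha> u j) k + Q k * u k) * v k)"
proof -
  let ?g = "\<lambda>j. P j * backward_diff h \<alpha> u j"
  have interior: "(\<Sum>k=0..N. F k) = (\<Sum>k=1..N-1. F k)" if "F 0 = 0" "F N = 0" for F :: "nat \<Rightarrow> real"
  proof (rule sum.mono_neutral_right)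
    show "\<forall>k\<in>{0..N} - {1..N-1}. F k = 0"
    proof
      fix k assume "k \<in> {0..N} - {1..N-1}"
      then have "k = 0 \<or> k = N" by auto
      then show "F k = 0" using that by auto
    qed
  qed auto
  have drop0: "(\<Sum>k=0..N. F k) = (\<Sum>k=1..N. F k)" if "F 0 = 0" for F :: "nat \<Rightarrow> real"
    using that by (simp add: sum.atLeast_Suc_atMost)
  have "backward_diff h \<alpha> v 0 = 0"
    using assms by (simp add: backward_diff_def)
  then have "energy h \<alpha> N P Q u v = (\<Sum>k=0..N. ?g k * backward_diff h \<alpha> v k + Q k * u k * v k)"
    unfolding energy_def using assms by (subst drop0) auto
  also have "\<dots> = (\<Sum>k=0..N. (forward_diff h \<alpha> N ?g k + Q k * u k) * v k)"
    using fractional_summation_by_parts[where g = ?g and f = v and h = h and \<alpha> = \<alpha> and N = N]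
    by (simp add: sum.distrib algebra_simps)
  also have "\<dots> = (\<Sum>k=1..N-1. (forward_diff h \<alpha> N ?g k + Q k * u k) * v k)"
    using assms by (intro interior) auto
  finally show ?thesis .
qed

section \<open>The first eigenvalue as the minimum of the energy\<close>

lemma functional_I_interior:
  assumes "y (grid a h N) = 0"
  shows "functional_I a h N r y = (\<Sum>k=1..N-1. r (grid a h k) * (y (grid a h k))\<^sup>2)"
  using assms by (cases N) (auto simp: functional_I_def)

lemma sl_solution_imp_J_eq:
  assumes "sl_solution a h N \<alpha> p q r lam y"
  shows "functional_J a h N \<alpha> p q y = lam * functional_I a h N r y"
proof -
  let ?y = "\<lambda>k. y (grid a h k)"
  have bc: "?y 0 = 0" "?y N = 0"
    using assms by (auto simp: sl_solution_def)
  have "functional_J a h N \<alpha> p q y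
      = (\<Sum>k=1..N-1. (lam * r (grid a h k) * ?y k) * ?y k)"
    unfolding functional_J_eq_energy energy_weak_form[where v = ?y, OF bc]
    using assms by (intro sum.cong) (auto simp: sl_solution_def)
  also have "\<dots> = lam * functional_I a h N r y"
    by (simp add: functional_I_interior[where y = y, OF bc(2)] sum_distrib_left power2_eq_square mult.assoc)
  finally show ?thesis .
qed

lemma inj_grid: "h > 0 \<Longrightarrow> inj (grid a h)"
  by (auto simp: inj_def grid_def)

text \<open>The constrained minimizer of \<open>J\<close>, tested against unit sequences, satisfies the difference
  equation pointwise.\<close>

lemma ex_eigenvalue_below_J:
  assumes "h > 0" and "N \<ge> 2" and r: "\<And>i. i \<le> N \<Longrightarrow> r (grid a h i) > 0"
  obtains \<mu> where "sl_eigenvalue a h N \<alpha> p q r \<mu>"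
    and "\<And>y. y (grid a h 0) = 0 \<Longrightarrow> y (grid a h N) = 0 \<Longrightarrow>
           \<mu> * functional_I a h N r y \<le> functional_J a h N \<alpha> p q y"
proof -
  let ?S = "{1..N-1}" and ?w = "\<lambda>k. r (grid a h k)"
  let ?P = "\<lambda>k. p (grid a h k)" and ?Q = "\<lambda>k. q (grid a h k)"
  let ?B = "energy h \<alpha> N ?P ?Q"
  have "?S \<noteq> {}" using \<open>N \<ge> 2\<close> by simp
  have w_pos: "?w k > 0" if "k \<in> ?S" for k
    using that by (intro r) auto
  obtain m where supp: "\<And>k. k \<notin> ?S \<Longrightarrow> m k = 0" and unit: "(\<Sum>k\<in>?S. ?w k * (m k)\<^sup>2) = 1"
    and lower: "\<And>v. (\<And>k. k \<notin> ?S \<Longrightarrow> v k = 0) \<Longrightarrow> ?B m m * (\<Sum>k\<in>?S. ?w k * (v k)\<^sup>2) \<le> ?B v v"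
    and weak: "\<And>v. (\<And>k. k \<notin> ?S \<Longrightarrow> v k = 0) \<Longrightarrow> ?B m v = ?B m m * (\<Sum>k\<in>?S. ?w k * m k * v k)"
    using rayleigh_minimizer[where B = ?B and S = ?S and w = ?w, OF _ \<open>?S \<noteq> {}\<close> w_pos energy_commute
        energy_add_scale_left continuous_on_energy] by blast
  \<comment> \<open>Only the values of \<open>y\<close> on the grid matter; the grid points are distinct since \<open>h > 0\<close>.\<close>
  define y where "y = m \<circ> inv (grid a h)"
  have y_grid: "y (grid a h k) = m k" for k
    using inj_grid[OF \<open>h > 0\<close>] by (simp add: y_def)
  have "sl_solution a h N \<alpha> p q r (?B m m) y"
    unfolding sl_solution_def y_grid
  proof (intro conjI ballI)
    fix k assume k: "k \<in> ?S"
    let ?e = "\<lambda>j. if j = k then 1 else 0 :: real"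
    have "?e 0 = 0" "?e N = 0" using k by auto
    then have "?B m ?e = forward_diff h \<alpha> N (\<lambda>j. ?P j * backward_diff h \<alpha> m j) k + ?Q k * m k"
      unfolding energy_weak_form[where v = ?e, OF \<open>?e 0 = 0\<close> \<open>?e N = 0\<close>]
      using k by (simp add: if_distrib[of "\<lambda>x. _ * x"] cong: if_cong)
    moreover have "?B m ?e = ?B m m * ?w k * m k"
    proof -
      have "?e j = 0" if "j \<notin> ?S" for j using that k by auto
      from weak[OF this] show ?thesis
        using k by (simp add: if_distrib[of "\<lambda>x. _ * x"] mult.assoc cong: if_cong)
    qed
    ultimately show "forward_diff h \<alpha> N (\<lambda>j. ?P j * backward_diff h \<alpha> (\<lambda>i. m i) j) k + ?Q k * m k
        = ?B m m * ?w k * m k"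
      by simp
  qed (use supp \<open>N \<ge> 2\<close> in auto)
  moreover have "\<exists>k\<in>{0..N}. y (grid a h k) \<noteq> 0"
  proof (rule ccontr)
    assume "\<not> ?thesis"
    then have "(\<Sum>k\<in>?S. ?w k * (m k)\<^sup>2) = 0"
      by (intro sum.neutral) (auto simp: y_grid)
    with unit show False by simp
  qed
  ultimately have "sl_eigenvalue a h N \<alpha> p q r (?B m m)"
    by (auto simp: sl_eigenvalue_def sl_eigenfunction_def)
  moreover have "?B m m * functional_I a h N r z \<le> functional_J a h N \<alpha> p q z"
    if z: "z (grid a h 0) = 0" "z (grid a h N) = 0" for z
  proof -
    define v where "v k = (if k \<in> ?S then z (grid a h k) else 0)" for k
    have "z (grid a h k) = v k" if "k \<le> N" for k
    proof -
      have "k = 0 \<or> k = N \<or> k \<in> ?S" using that by auto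
      then show ?thesis using z by (auto simp: v_def)
    qed
    then have "functional_J a h N \<alpha> p q z = ?B v v"
      unfolding functional_J_eq_energy by (rule energy_cong_upto)
    moreover have "functional_I a h N r z = (\<Sum>k\<in>?S. ?w k * (v k)\<^sup>2)"
      by (simp add: functional_I_interior[where y = z, OF z(2)] v_def)
    moreover have "v k = 0" if "k \<notin> ?S" for k
      using that by (simp only: v_def if_False)
    ultimately show ?thesis
      using lower[of v] by presburger
  qed
  ultimately show thesis by (rule that)
qed

theorem theorem2p5:
  fixes a h \<alpha> lam1 :: real and N :: nat and p q r y\<^sub>1 :: "real \<Rightarrow> real"
  assumes "h > 0" and "N \<ge> 2" and "0 < \<alpha>" and "\<alpha> \<le> 1"
    and "\<And>i. i \<le> N \<Longrightarrow> p (grid a h i) > 0"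
    and "\<And>i. i \<le> N \<Longrightarrow> r (grid a h i) > 0"
    and "first_sl_eigenvalue a h N \<alpha> p q r lam1"
    and "sl_eigenfunction a h N \<alpha> p q r lam1 y\<^sub>1"
    and "functional_I a h N r y\<^sub>1 = 1"
  shows "is_arg_min (functional_J a h N \<alpha> p q)
           (\<lambda>y. y (grid a h 0) = 0 \<and> y (grid a h N) = 0 \<and> functional_I a h N r y = 1) y\<^sub>1
         \<and> functional_J a h N \<alpha> p q y\<^sub>1 = lam1"
proof -
  have sol: "sl_solution a h N \<alpha> p q r lam1 y\<^sub>1"
    using assms(8) by (simp add: sl_eigenfunction_def)
  have J1: "functional_J a h N \<alpha> p q y\<^sub>1 = lam1"
    using sl_solution_imp_J_eq[OF sol] assms(9) by simp
  obtain \<mu> where "sl_eigenvalue a h N \<alpha> p q r \<mu>"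
    and lower: "\<And>y. y (grid a h 0) = 0 \<Longrightarrow> y (grid a h N) = 0 \<Longrightarrow>
      \<mu> * functional_I a h N r y \<le> functional_J a h N \<alpha> p q y"
    using ex_eigenvalue_below_J[where a = a and r = r and \<alpha> = \<alpha> and p = p and q = q, OF assms(1,2,6)] by blast
  then have "lam1 \<le> \<mu>"
    using assms(7) by (simp add: first_sl_eigenvalue_def)
  have "lam1 \<le> functional_J a h N \<alpha> p q y"
    if "y (grid a h 0) = 0" "y (grid a h N) = 0" "functional_I a h N r y = 1" for y
    using lower[OF that(1,2)] that(3) \<open>lam1 \<le> \<mu>\<close> by simp
  then show ?thesis
    using sol assms(9) J1 by (auto simp: is_arg_min_def sl_solution_def not_less)
qed

end
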